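(* If $R$ is a finite ring and $\mathbb{F}$ is a finite field whose characteristic divides $|R|$, then for any network $\mathcal{N}$ the linear rate region of $\mathcal{N}$ over $R$ is contained in its linear rate region over $\mathbb{F}$, i.e., $\mathcal{R}_{lin}(\mathcal{N},R)\subseteq\mathcal{R}_{lin}(\mathcal{N},\mathbb{F})$.
   Context: Rings are associative with identity $1$, not necessarily commutative. A network is a finite directed acyclic multigraph, some of whose nodes are sources or receivers, with finitely many message vectors (say $m$ of them), each originating at a source node; each receiver demands a specified set of the message vectors. The inputs of a node are the message vectors originating at the node together with the vectors carried by its incoming edges. For integers $k_1,\dots,k_m\ge 0$ and $n\ge 1$, a $(k_1,\dots,k_m,n)$ code over a finite alphabet $\mathcal{A}$ (with $|\mathcal{A}|\ge 2$) lets the $i$th message vector range over $\mathcal{A}^{k_i}$, assigns to each edge an edge function mapping the inputs of the edge's tail node to a vector in $\mathcal{A}^n$ (the vector carried by the edge), and assigns to each receiver and each message vector it demands a decoding function of the receiver's inputs. The code is a solution if, for all values of the message vectors, each decoding function outputs the demanded message vector. Its rate vector is $(k_1/n,\dots,k_m/n)$. For a finite ring $R$, a code over the alphabet $R$ is two-sided linear if every component of every edge function and decoding function, as a function of the components $x_1,\dots,x_s\in R$ of the node's input vectors, has the form $\sum_{i=1}^{s}\sum_{j=1}^{n_i} a_{i,j}\,x_i\,b_{i,j}$ with $a_{i,j},b_{i,j}\in R$. (Equivalently, it is linear over $R$ viewed as a left module over $R\otimes_{\mathbb{Z}}R^{op}$ with $\left(\sum_i a_i\otimes b_i\right)\cdot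 x=\sum_i a_i x b_i$; for commutative $R$, in particular for a field, this is the same as ordinary linearity $\mathbf{x}\mapsto A\mathbf{x}$ with $A$ a matrix over $R$.) A rate vector $\mathbf{r}$ is linearly achievable for $\mathcal{N}$ over $R$ if $\mathcal{N}$ has a two-sided linear solution over $R$ (for some block sizes) with rate vector $\mathbf{r}$, and $\mathcal{R}_{lin}(\mathcal{N},R)=\{\mathbf{r}\in\mathbb{Q}^m : \mathbf{r}\text{ is linearly achievable for }\mathcal{N}\text{ over }R\}$. *)

theory Defs
  imports Graph_Theory.Digraph "HOL-Algebra.Ring" "HOL-Algebra.Multiplicative_Group"
    "HOL-Library.FuncSet" HOL.Rat
begin

record ('v, 'e) net =
  net_graph :: "('v, 'e) pre_digraph"
  sources :: "'v set"
  receivers :: "'v set"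
  num_msgs :: nat
  origin :: "nat \<Rightarrow> 'v"
  demands :: "'v \<Rightarrow> nat set"

locale network = fin_digraph "net_graph N" for N :: "('v, 'e) net" +
  assumes acyclic_arcs: "acyclic (arcs_ends (net_graph N))"
    and sources_in_verts: "sources N \<subseteq> verts (net_graph N)"
    and receivers_in_verts: "receivers N \<subseteq> verts (net_graph N)"
    and origin_in_sources: "i < num_msgs N \<Longrightarrow> origin N i \<in> sources N"
    and demands_msgs: "v \<in> receivers N \<Longrightarrow> demands N v \<subseteq> {..<num_msgs N}"

datatype 'e input = Msg nat | Arc 'e

definition inputs :: "('v, 'e) net \<Rightarrow> 'v \<Rightarrow> 'e input set" where
  "inputs N v = Msg ` {i. i < num_msgs N \<and> origin N i = v} \<union> Arc ` in_arcs (net_graph N) v"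

primrec input_length :: "(nat \<Rightarrow> nat) \<Rightarrow> nat \<Rightarrow> 'e input \<Rightarrow> nat" where
  "input_length k n (Msg i) = k i"
| "input_length k n (Arc e) = n"

text \<open>
  A vector in \<open>A\<^sup>l\<close> is an element of \<open>{..<l} \<rightarrow>\<^sub>E A\<close>.  The tuple of all input vectors of a
  node is flattened into a single family of components: the component \<open>(s, c)\<close> is the
  \<open>c\<close>-th component of the input vector \<open>s\<close>.
\<close>

definition input_components ::
    "('v, 'e) net \<Rightarrow> (nat \<Rightarrow> nat) \<Rightarrow> nat \<Rightarrow> 'v \<Rightarrow> ('e input \<times> nat) set" where
  "input_components N k n v = (SIGMA s : inputs N v. {..<input_length k n s})"

type_synonym ('e, 'a) input_vectors = "'e input \<times> nat \<Rightarrow> 'a"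

text \<open>
  In a code, \<open>ef e\<close> is the edge function of the edge \<open>e\<close>, and \<open>df v i\<close> is the decoding function
  of the receiver \<open>v\<close> for the message \<open>i\<close>.
\<close>

definition is_code ::
    "('v, 'e) net \<Rightarrow> 'a set \<Rightarrow> (nat \<Rightarrow> nat) \<Rightarrow> nat
      \<Rightarrow> ('e \<Rightarrow> ('e, 'a) input_vectors \<Rightarrow> nat \<Rightarrow> 'a)
      \<Rightarrow> ('v \<Rightarrow> nat \<Rightarrow> ('e, 'a) input_vectors \<Rightarrow> nat \<Rightarrow> 'a) \<Rightarrow> bool" where
  "is_code N A k n ef df \<longleftrightarrow>
     finite A \<and> card A \<ge> 2 \<and> n \<ge> 1 \<and>
     (\<forall>e\<in>arcs (net_graph N).
        ef e \<in> (input_components N k n (tail (net_graph N) e) \<rightarrow>\<^sub>E A) \<rightarrow> ({..<n} \<rightarrow>\<^sub>E A)) \<and>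
     (\<forall>v\<in>receivers N. \<forall>i\<in>demands N v.
        df v i \<in> (input_components N k n v \<rightarrow>\<^sub>E A) \<rightarrow> ({..<k i} \<rightarrow>\<^sub>E A))"

definition node_inputs ::
    "('v, 'e) net \<Rightarrow> (nat \<Rightarrow> nat) \<Rightarrow> nat \<Rightarrow> 'v \<Rightarrow> (nat \<Rightarrow> nat \<Rightarrow> 'a) \<Rightarrow> ('e \<Rightarrow> nat \<Rightarrow> 'a)
      \<Rightarrow> ('e, 'a) input_vectors" where
  "node_inputs N k n v w z =
     (\<lambda>(s, c)\<in>input_components N k n v. case s of Msg i \<Rightarrow> w i c | Arc e \<Rightarrow> z e c)"

text \<open>
  \<open>carried N k n ef w z\<close>: if the messages are \<open>w\<close>, then the edges carry the vectors \<open>z\<close>.  Since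
  the graph is acyclic, \<open>z\<close> exists and is uniquely determined on the edges (lemma
  \<open>carried_unique\<close> below), so that the universal quantifier over \<open>z\<close> in \<open>is_solution\<close> ranges
  over exactly one assignment of vectors to edges for each \<open>w\<close>.
\<close>

definition carried ::
    "('v, 'e) net \<Rightarrow> (nat \<Rightarrow> nat) \<Rightarrow> nat \<Rightarrow> ('e \<Rightarrow> ('e, 'a) input_vectors \<Rightarrow> nat \<Rightarrow> 'a)
      \<Rightarrow> (nat \<Rightarrow> nat \<Rightarrow> 'a) \<Rightarrow> ('e \<Rightarrow> nat \<Rightarrow> 'a) \<Rightarrow> bool" where
  "carried N k n ef w z \<longleftrightarrow>
     (\<forall>e\<in>arcs (net_graph N). z e = ef e (node_inputs N k n (tail (net_graph N) e) w z))"

definition is_solution ::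
    "('v, 'e) net \<Rightarrow> 'a set \<Rightarrow> (nat \<Rightarrow> nat) \<Rightarrow> nat
      \<Rightarrow> ('e \<Rightarrow> ('e, 'a) input_vectors \<Rightarrow> nat \<Rightarrow> 'a)
      \<Rightarrow> ('v \<Rightarrow> nat \<Rightarrow> ('e, 'a) input_vectors \<Rightarrow> nat \<Rightarrow> 'a) \<Rightarrow> bool" where
  "is_solution N A k n ef df \<longleftrightarrow>
     is_code N A k n ef df \<and>
     (\<forall>w \<in> (\<Pi>\<^sub>E i\<in>{..<num_msgs N}. {..<k i} \<rightarrow>\<^sub>E A). \<forall>z. carried N k n ef w z \<longrightarrow>
        (\<forall>v\<in>receivers N. \<forall>i\<in>demands N v. df v i (node_inputs N k n v w z) = w i))"

lemma (in network) wf_arcs: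
  "wf {(e', e). e' \<in> arcs (net_graph N) \<and> e \<in> arcs (net_graph N) \<and>
      head (net_graph N) e' = tail (net_graph N) e}"
proof -
  let ?G = "net_graph N"
  have fin: "finite (arcs_ends ?G)"
    by (simp add: arcs_ends_def)
  have "wf (arcs_ends ?G)"
    using finite_acyclic_wf[OF fin acyclic_arcs] .
  then have "wf (inv_image (arcs_ends ?G) (tail ?G))"
    by (rule wf_inv_image)
  then show ?thesis
    by (rule wf_subset) (force simp: inv_image_def arcs_ends_conv)
qed

lemma node_inputs_cong:
  assumes "\<And>e. e \<in> in_arcs (net_graph N) v \<Longrightarrow> z e = z' e"
  shows "node_inputs N k n v w z = node_inputs N k n v w z'"
  unfolding node_inputs_def
  by (rule restrict_ext) (auto simp: input_components_def inputs_def assms split: input.splits)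

lemma (in network) carried_unique:
  "\<exists>!z. z \<in> extensional (arcs (net_graph N)) \<and> carried N k n ef w z"
proof -
  let ?G = "net_graph N"
  let ?r = "{(e', e). e' \<in> arcs ?G \<and> e \<in> arcs ?G \<and> head ?G e' = tail ?G e}"
  define H where "H z e = ef e (node_inputs N k n (tail ?G e) w z)" for z e
  have cong: "H z e = H z' e"
    if "e \<in> arcs ?G" "\<And>e'. (e', e) \<in> ?r \<Longrightarrow> z e' = z' e'" for z z' e
    unfolding H_def using that by (subst node_inputs_cong[of N _ z z']) (auto simp: in_arcs_def)
  define z0 where "z0 = wfrec ?r H"
  have z0: "z0 e = H z0 e" if "e \<in> arcs ?G" for e
  proof -
    have "z0 e = H (cut z0 ?r e) e"
      unfolding z0_def by (rule wfrec[OF wf_arcs])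
    also have "\<dots> = H z0 e"
      by (rule cong[OF that]) (auto simp: cut_def)
    finally show ?thesis .
  qed
  define z where "z = restrict z0 (arcs ?G)"
  have "z e = H z e" if e: "e \<in> arcs ?G" for e
  proof -
    have "H z e = H z0 e"
      by (rule cong[OF e]) (auto simp: z_def)
    then show ?thesis
      using z0[OF e] e by (simp add: z_def)
  qed
  then have ex: "z \<in> extensional (arcs ?G) \<and> carried N k n ef w z"
    by (auto simp: carried_def H_def z_def)
  show ?thesis
  proof (rule ex1I[where a = z])
    show "z \<in> extensional (arcs ?G) \<and> carried N k n ef w z"
      by (rule ex)
  next
    fix y assume y: "y \<in> extensional (arcs ?G) \<and> carried N k n ef w y"
    have "e \<in> arcs ?G \<longrightarrow> y e = z e" for e
    proof (induction e rule: wf_induct_rule[OF wf_arcs])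
      case (1 e)
      show ?case
      proof
        assume e: "e \<in> arcs ?G"
        have "H y e = H z e"
          by (rule cong[OF e]) (use 1 in auto)
        then show "y e = z e"
          using y ex e by (auto simp: carried_def H_def)
      qed
    qed
    then show "y = z"
      using y ex by (intro extensionalityI[of y "arcs ?G" z]) auto
  qed
qed

text \<open>
  Functions \<open>f\<close> of finitely many variables \<open>x i\<close> (\<open>i \<in> I\<close>) over \<open>R\<close> that have the form
  \<open>f x = (\<Sum>i\<in>I. \<Sum>j<t i. a i j * x i * b i j)\<close>.
\<close>

definition two_sided_linear ::
    "('a, 'r) ring_scheme \<Rightarrow> 'i set \<Rightarrow> (('i \<Rightarrow> 'a) \<Rightarrow> 'a) \<Rightarrow> bool" where
  "two_sided_linear R I f \<longleftrightarrow>
     (\<exists>(t :: 'i \<Rightarrow> nat) a b.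
        (\<forall>i\<in>I. \<forall>j<t i. a i j \<in> carrier R \<and> b i j \<in> carrier R) \<and>
        (\<forall>x \<in> I \<rightarrow>\<^sub>E carrier R.
           f x = (\<Oplus>\<^bsub>R\<^esub>i\<in>I. \<Oplus>\<^bsub>R\<^esub>j\<in>{..<t i}. a i j \<otimes>\<^bsub>R\<^esub> x i \<otimes>\<^bsub>R\<^esub> b i j)))"

definition two_sided_linear_code ::
    "('v, 'e) net \<Rightarrow> ('a, 'r) ring_scheme \<Rightarrow> (nat \<Rightarrow> nat) \<Rightarrow> nat
      \<Rightarrow> ('e \<Rightarrow> ('e, 'a) input_vectors \<Rightarrow> nat \<Rightarrow> 'a)
      \<Rightarrow> ('v \<Rightarrow> nat \<Rightarrow> ('e, 'a) input_vectors \<Rightarrow> nat \<Rightarrow> 'a) \<Rightarrow> bool" where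
  "two_sided_linear_code N R k n ef df \<longleftrightarrow>
     is_code N (carrier R) k n ef df \<and>
     (\<forall>e\<in>arcs (net_graph N). \<forall>c<n.
        two_sided_linear R (input_components N k n (tail (net_graph N) e)) (\<lambda>x. ef e x c)) \<and>
     (\<forall>v\<in>receivers N. \<forall>i\<in>demands N v. \<forall>c<k i.
        two_sided_linear R (input_components N k n v) (\<lambda>x. df v i x c))"

text \<open>Elements of \<open>\<rat>\<^sup>m\<close> are elements of \<open>{..<m} \<rightarrow>\<^sub>E UNIV\<close>.\<close>

definition rate_vector :: "('v, 'e) net \<Rightarrow> (nat \<Rightarrow> nat) \<Rightarrow> nat \<Rightarrow> nat \<Rightarrow> rat" where
  "rate_vector N k n = (\<lambda>i\<in>{..<num_msgs N}. of_nat (k i) / of_nat n)"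

definition linearly_achievable ::
    "('v, 'e) net \<Rightarrow> ('a, 'r) ring_scheme \<Rightarrow> (nat \<Rightarrow> rat) \<Rightarrow> bool" where
  "linearly_achievable N R r \<longleftrightarrow>
     (\<exists>k n ef df. two_sided_linear_code N R k n ef df \<and>
        is_solution N (carrier R) k n ef df \<and> r = rate_vector N k n)"

definition linear_rate_region ::
    "('v, 'e) net \<Rightarrow> ('a, 'r) ring_scheme \<Rightarrow> (nat \<Rightarrow> rat) set" where
  "linear_rate_region N R =
     {r \<in> {..<num_msgs N} \<rightarrow>\<^sub>E UNIV. linearly_achievable N R r}"

text \<open>
  The characteristic is the additive order of the identity; the library's \<open>group.ord\<close> is \<open>0\<close>
  for elements of infinite order.
\<close>

definition ring_char :: "('a, 'r) ring_scheme \<Rightarrow> nat" where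
  "ring_char R = group.ord (add_monoid R) \<one>\<^bsub>R\<^esub>"

end

theory Submission
  imports Defs "HOL-Algebra.Sylow" "HOL-Number_Theory.Cong"
begin

text \<open>
  Let \<open>p\<close> be the characteristic of \<open>F\<close>.  Since \<open>p\<close> divides \<open>|R|\<close>, the two-sided ideal
  \<open>V = {x \<in> R. p x = 0}\<close> is nonzero, and it is a vector space over the prime field, of dimension
  \<open>d > 0\<close> say.  Every map \<open>x \<mapsto> \<Sum> a x b\<close> preserves \<open>V\<close>, so a linear solution over \<open>R\<close> restricts to
  one over the alphabet \<open>V\<close>, whose functions are additive.  In coordinates they are matrices over the
  prime field of \<open>F\<close>, and the same matrices define a code over \<open>F\<close> all of whose block lengths are
  multiplied by \<open>d\<close>.  Every message over \<open>F\<close> is an \<open>F\<close>-linear combination of coordinate vectors of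
  messages over \<open>V\<close>, so by superposition this code is again a solution.
\<close>

section \<open>Finite sums and additive maps\<close>

context abelian_monoid
begin

lemma finsum_times:
  assumes "finite A" "finite B" "\<And>a b. a \<in> A \<Longrightarrow> b \<in> B \<Longrightarrow> g a b \<in> carrier G"
  shows "(\<Oplus>q\<in>A \<times> B. g (fst q) (snd q)) = (\<Oplus>a\<in>A. \<Oplus>b\<in>B. g a b)"
  using assms(1,3)
proof (induction A rule: finite_induct)
  case (insert a A)
  have "(\<Oplus>q\<in>insert a A \<times> B. g (fst q) (snd q))
      = (\<Oplus>q\<in>Pair a ` B \<union> A \<times> B. g (fst q) (snd q))"
    by (rule arg_cong[where f = "finsum G _"]) auto
  also have "\<dots> = (\<Oplus>q\<in>Pair a ` B. g (fst q) (snd q)) \<oplus> (\<Oplus>q\<in>A \<times> B. g (fst q) (snd q))"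
    using insert assms(2) by (intro finsum_Un_disjoint) auto
  also have "(\<Oplus>q\<in>Pair a ` B. g (fst q) (snd q)) = (\<Oplus>b\<in>B. g a b)"
    using insert by (subst finsum_reindex) (auto intro: inj_onI)
  finally show ?case
    using insert assms(2) by (simp add: finsum_insert)
qed simp

lemma finsum_swap:
  assumes "finite A" "finite B" "\<And>a b. a \<in> A \<Longrightarrow> b \<in> B \<Longrightarrow> g a b \<in> carrier G"
  shows "(\<Oplus>a\<in>A. \<Oplus>b\<in>B. g a b) = (\<Oplus>b\<in>B. \<Oplus>a\<in>A. g a b)"
  using assms(1,3)
proof (induction A rule: finite_induct)
  case (insert a A)
  have "(\<Oplus>b\<in>B. \<Oplus>a\<in>insert a A. g a b) = (\<Oplus>b\<in>B. g a b \<oplus> (\<Oplus>a\<in>A. g a b))"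
    using insert by (intro finsum_cong') auto
  also have "\<dots> = (\<Oplus>b\<in>B. g a b) \<oplus> (\<Oplus>b\<in>B. \<Oplus>a\<in>A. g a b)"
    using insert by (intro finsum_addf) auto
  finally show ?case
    using insert by auto
qed simp

end

lemma additive_finsum:
  assumes "abelian_group G" "abelian_group H" "h \<in> hom (add_monoid G) (add_monoid H)"
    and "f \<in> A \<rightarrow> carrier G"
  shows "h (finsum G f A) = (\<Oplus>\<^bsub>H\<^esub>a\<in>A. h (f a))"
proof -
  interpret G: abelian_group G by fact
  interpret H: abelian_group H by fact
  have add: "h x \<in> carrier H" "h (x \<oplus>\<^bsub>G\<^esub> y) = h x \<oplus>\<^bsub>H\<^esub> h y"
    if "x \<in> carrier G" "y \<in> carrier G" for x y
    using assms(3) that by (auto simp: hom_def)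
  have zero: "h \<zero>\<^bsub>G\<^esub> = \<zero>\<^bsub>H\<^esub>"
    using hom_one[OF assms(3)] G.add.is_group H.add.is_group by simp
  show ?thesis
    using assms(4)
  proof (induction A rule: infinite_finite_induct)
    case (insert a A)
    then have "f \<in> A \<rightarrow> carrier G" "f a \<in> carrier G" by auto
    then show ?case using insert add by (auto simp: Pi_def)
  qed (auto simp: zero)
qed

lemma additive_int_pow:
  fixes m :: int
  assumes "abelian_group G" "abelian_group H" "h \<in> hom (add_monoid G) (add_monoid H)"
    and "x \<in> carrier G"
  shows "h ([m] \<cdot>\<^bsub>G\<^esub> x) = [m] \<cdot>\<^bsub>H\<^esub> h x"
proof -
  interpret G: abelian_group G by fact
  interpret H: abelian_group H by fact
  show ?thesis
    using hom_int_pow[OF assms(3)] assms(4) G.add.is_group H.add.is_group by (simp add: add_pow_def)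
qed

section \<open>Bases over the prime field and dual coordinates\<close>

context abelian_group
begin

lemma int_multiple_eq_0:
  assumes "x \<in> carrier G" "[int p] \<cdot> x = \<zero>" "int p dvd m"
  shows "[m] \<cdot> x = \<zero>"
proof -
  obtain j where "m = int p * j" using assms(3) by auto
  then have "[m] \<cdot> x = [j] \<cdot> ([int p] \<cdot> x)"
    using assms(1) by (simp add: add.int_pow_pow mult.commute)
  then show ?thesis using assms by simp
qed

lemma finsum_int_multiple:
  fixes m :: "'c \<Rightarrow> int"
  assumes "\<And>l. l \<in> A \<Longrightarrow> b l \<in> carrier G"
  shows "(\<Oplus>l\<in>A. [(j * m l)] \<cdot> b l) = [j] \<cdot> (\<Oplus>l\<in>A. [m l] \<cdot> b l)"
  using assms
  by (induction A rule: infinite_finite_induct)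
    (auto simp: add.int_pow_distrib add.int_pow_pow mult.commute)

lemma finsum_int_add:
  fixes m m' :: "'c \<Rightarrow> int"
  assumes "\<And>l. l \<in> A \<Longrightarrow> b l \<in> carrier G"
  shows "(\<Oplus>l\<in>A. [(m l + m' l)] \<cdot> b l) = (\<Oplus>l\<in>A. [m l] \<cdot> b l) \<oplus> (\<Oplus>l\<in>A. [m' l] \<cdot> b l)"
  using assms
  by (subst finsum_addf[symmetric]) (auto simp: add.int_pow_mult simp del: finsum_addf intro!: finsum_cong')

text \<open>Linear independence over the field with \<open>p\<close> elements, phrased with integer
  coefficients so that no scalar action has to be built. In a group annihilated by \<open>p\<close>
  a coefficient matters only modulo \<open>p\<close>, hence divisibility by \<open>p\<close> takes
  the place of vanishing.\<close>

definition independent_mod :: "nat \<Rightarrow> nat \<Rightarrow> (nat \<Rightarrow> 'a) \<Rightarrow> bool" where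
  "independent_mod p d b \<longleftrightarrow> (\<forall>l<d. b l \<in> carrier G) \<and>
     (\<forall>m :: nat \<Rightarrow> int. (\<Oplus>l\<in>{..<d}. [m l] \<cdot> b l) = \<zero> \<longrightarrow> (\<forall>l<d. int p dvd m l))"

lemma independent_modD:
  fixes m :: "nat \<Rightarrow> int"
  assumes "independent_mod p d b" "(\<Oplus>l\<in>{..<d}. [m l] \<cdot> b l) = \<zero>" "l < d"
  shows "int p dvd m l"
  using assms unfolding independent_mod_def by blast

text \<open>An independent family cannot repeat a value, since \<open>b i = b j\<close> would be a
  relation whose coefficient at \<open>i\<close> is one. The bound guarantees that a longest
  independent family exists.\<close>

lemma independent_mod_le_card:
  assumes "finite (carrier G)" "p > 1" "independent_mod p d b"
  shows "d \<le> card (carrier G)"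
proof -
  have b: "b l \<in> carrier G" if "l < d" for l
    using assms(3) that by (auto simp: independent_mod_def)
  have "inj_on b {..<d}"
  proof (rule inj_onI, rule ccontr)
    fix i j assume ij: "i \<in> {..<d}" "j \<in> {..<d}" "b i = b j" "i \<noteq> j"
    \<comment> \<open>These are the coefficients of \<open>b i - b j\<close>, written as a sum of
      two indicators so that \<open>finsum_int_add\<close> splits the relation into two sums with at
      most one nonzero term each.\<close>
    define m :: "nat \<Rightarrow> int" where "m l = (if l = i then 1 else 0) + (if l = j then - 1 else 0)" for l
    have zero_multiple: "[(0::int)] \<cdot> x = \<zero>" for x
      by (simp add: add_pow_def)
    have 1: "(\<Oplus>l\<in>{..<d}. [(if l = i' then c else 0)] \<cdot> b l) = [c] \<cdot> b i'" if "i' < d" for i' and c :: int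
    proof -
      have "(\<Oplus>l\<in>{..<d}. [(if l = i' then c else 0)] \<cdot> b l) = (\<Oplus>l\<in>{..<d}. if i' = l then [c] \<cdot> b l else \<zero>)"
        using b that zero_multiple by (intro finsum_cong') auto
      also have "\<dots> = [c] \<cdot> b i'"
        using b that by (intro finsum_singleton) auto
      finally show ?thesis .
    qed
    have "(\<Oplus>l\<in>{..<d}. [m l] \<cdot> b l) = \<zero>"
      unfolding m_def using ij b by (subst finsum_int_add) (auto simp: 1 add.int_pow_neg r_neg)
    then have "int p dvd m i"
      using assms(3) ij by (auto simp: independent_mod_def)
    then show False
      using ij assms(2) by (simp add: m_def)
  qed
  then have "card {..<d} \<le> card (carrier G)"
    using b assms(1) by (intro card_inj_on_le) auto
  then show ?thesis by simp
qed

text \<open>An independent family of greatest length spans, because an \<open>x\<close> outside its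
  span could be appended at index \<open>d\<close>. In a relation of the extended family the
  coefficient of \<open>x\<close> must be divisible by \<open>p\<close>; the term of
  \<open>x\<close> then vanishes and the independence of \<open>b\<close> handles the rest.\<close>

lemma ex_basis_mod_prime:
  assumes fin: "finite (carrier G)" and p: "prime p"
    and tors: "\<And>x. x \<in> carrier G \<Longrightarrow> [int p] \<cdot> x = \<zero>"
  obtains d b where "independent_mod p d b"
    and "\<And>x. x \<in> carrier G \<Longrightarrow> \<exists>m :: nat \<Rightarrow> int. x = (\<Oplus>l\<in>{..<d}. [m l] \<cdot> b l)"
proof -
  let ?P = "\<lambda>d. \<exists>b. independent_mod p d b"
  have P0: "?P 0" by (simp add: independent_mod_def)
  have bound: "d \<le> card (carrier G)" if "?P d" for d
    using independent_mod_le_card[OF fin prime_gt_1_nat[OF p]] that by blast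
  define d where "d = (GREATEST d. ?P d)"
  have d: "?P d"
    unfolding d_def using P0 bound by (rule GreatestI_nat)
  have max: "d' \<le> d" if "?P d'" for d'
    unfolding d_def using that bound by (rule Greatest_le_nat)
  from d obtain b where ind: "independent_mod p d b" by blast
  then have b: "b l \<in> carrier G" if "l < d" for l
    using that by (auto simp: independent_mod_def)
  have "\<exists>m :: nat \<Rightarrow> int. x = (\<Oplus>l\<in>{..<d}. [m l] \<cdot> b l)" if x: "x \<in> carrier G" for x
  proof (rule ccontr)
    assume contr: "\<nexists>m :: nat \<Rightarrow> int. x = (\<Oplus>l\<in>{..<d}. [m l] \<cdot> b l)"
    have "independent_mod p (Suc d) (b(d := x))"
      unfolding independent_mod_def
    proof (intro conjI allI impI)
      fix l assume "l < Suc d" then show "(b(d := x)) l \<in> carrier G"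
        using b x by (auto simp: less_Suc_eq)
    next
      fix m :: "nat \<Rightarrow> int" and l
      assume sum: "(\<Oplus>l\<in>{..<Suc d}. [m l] \<cdot> (b(d := x)) l) = \<zero>" and l: "l < Suc d"
      let ?s = "\<Oplus>l\<in>{..<d}. [m l] \<cdot> b l"
      have s: "?s \<in> carrier G" using b by auto
      have "(\<Oplus>l\<in>{..<d}. [m l] \<cdot> (b(d := x)) l) = ?s"
        using b by (intro finsum_cong') auto
      moreover have "(\<Oplus>l\<in>{..<Suc d}. [m l] \<cdot> (b(d := x)) l)
          = [m d] \<cdot> x \<oplus> (\<Oplus>l\<in>{..<d}. [m l] \<cdot> (b(d := x)) l)"
        unfolding lessThan_Suc using b x by (subst finsum_insert) auto
      ultimately have eq: "[m d] \<cdot> x \<oplus> ?s = \<zero>" using sum by simp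
      have pm: "int p dvd m d"
      proof (rule ccontr)
        assume "\<not> int p dvd m d"
        then have "coprime (m d) (int p)"
          using p by (simp add: prime_imp_coprime coprime_commute)
        \<comment> \<open>With \<open>j\<close> inverse to \<open>m d\<close> modulo
          \<open>p\<close>, the multiple of \<open>x\<close> by \<open>m d * j\<close> is
          \<open>x\<close> itself. The relation can thus be solved for \<open>x\<close> with
          coefficients \<open>- j * m l\<close>, which puts \<open>x\<close> into the span.\<close>
        then obtain j where "[m d * j = 1] (mod int p)"
          using cong_solve_coprime_int by blast
        then have "int p dvd m d * j - 1" by (simp add: cong_iff_dvd_diff)
        then have "[(m d * j - 1)] \<cdot> x = \<zero>"
          using int_multiple_eq_0 x tors by blast
        then have "[(m d * j - 1 + 1)] \<cdot> x = x"
          using x by (subst add.int_pow_mult) auto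
        then have "[j] \<cdot> ([m d] \<cdot> x) = x"
          using x by (simp add: add.int_pow_pow)
        moreover have "[m d] \<cdot> x = \<ominus> ?s"
          using eq s x by (simp add: minus_equality)
        ultimately have "x = [(- j)] \<cdot> ?s"
          using s by (simp add: add.int_pow_inv add.int_pow_neg)
        also have "\<dots> = (\<Oplus>l\<in>{..<d}. [(- j * m l)] \<cdot> b l)"
          using b by (intro finsum_int_multiple[symmetric]) auto
        finally show False using contr by (auto dest: spec[of _ "\<lambda>l. - j * m l"])
      qed
      then have "?s = \<zero>"
        using eq int_multiple_eq_0[OF x tors[OF x] pm] s by simp
      then show "int p dvd m l"
        using ind pm l by (auto simp: independent_mod_def less_Suc_eq)
    qed
    then show False using max[of "Suc d"] by auto
  qed
  then show ?thesis using that ind by blast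
qed

end

text \<open>The integer coefficients of an element of \<open>G\<close> are determined only modulo
  \<open>p\<close>, but \<open>p\<close> annihilates the identity of \<open>F\<close>, so their
  images in \<open>F\<close> are well defined. These images are the coordinates
  \<open>\<kappa> l\<close>. Taking them in \<open>F\<close> lets them serve directly as entries of
  matrices over \<open>F\<close>.\<close>

lemma ex_dual_basis:
  fixes G :: "('a, 'r) ring_scheme" and F :: "('b, 'f) ring_scheme" and p :: nat
  assumes "abelian_group G" "finite (carrier G)" "prime p"
    and tors: "\<And>x. x \<in> carrier G \<Longrightarrow> [p] \<cdot>\<^bsub>G\<^esub> x = \<zero>\<^bsub>G\<^esub>"
    and "ring F" "[p] \<cdot>\<^bsub>F\<^esub> \<one>\<^bsub>F\<^esub> = \<zero>\<^bsub>F\<^esub>"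
  obtains d :: nat and b :: "nat \<Rightarrow> 'a" and \<kappa> :: "nat \<Rightarrow> 'a \<Rightarrow> 'b"
  where "\<And>l. l < d \<Longrightarrow> b l \<in> carrier G"
    and "\<And>l. l < d \<Longrightarrow> \<kappa> l \<in> hom (add_monoid G) (add_monoid F)"
    and "\<And>l l'. l < d \<Longrightarrow> l' < d \<Longrightarrow> \<kappa> l (b l') = (if l = l' then \<one>\<^bsub>F\<^esub> else \<zero>\<^bsub>F\<^esub>)"
    and "\<And>\<psi> v. \<psi> \<in> hom (add_monoid G) (add_monoid F) \<Longrightarrow> v \<in> carrier G \<Longrightarrow>
      \<psi> v = (\<Oplus>\<^bsub>F\<^esub>l\<in>{..<d}. \<kappa> l v \<otimes>\<^bsub>F\<^esub> \<psi> (b l))"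
    and "carrier G \<noteq> {\<zero>\<^bsub>G\<^esub>} \<Longrightarrow> d > 0"
proof -
  interpret G: abelian_group G by fact
  interpret F: ring F by fact
  have torsG: "[int p] \<cdot>\<^bsub>G\<^esub> x = \<zero>\<^bsub>G\<^esub>" if "x \<in> carrier G" for x
    using tors[OF that] by (simp add: add_pow_def int_pow_int)
  obtain d b where ind: "G.independent_mod p d b"
    and span: "\<And>x. x \<in> carrier G \<Longrightarrow> \<exists>m :: nat \<Rightarrow> int. x = (\<Oplus>\<^bsub>G\<^esub>l\<in>{..<d}. [m l] \<cdot>\<^bsub>G\<^esub> b l)"
    using G.ex_basis_mod_prime[OF assms(2,3) torsG] by blast
  have b: "b l \<in> carrier G" if "l < d" for l
    using ind that by (auto simp: G.independent_mod_def)
  define m where "m x = (SOME m :: nat \<Rightarrow> int. x = (\<Oplus>\<^bsub>G\<^esub>l\<in>{..<d}. [m l] \<cdot>\<^bsub>G\<^esub> b l))" for x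
  have m: "x = (\<Oplus>\<^bsub>G\<^esub>l\<in>{..<d}. [m x l] \<cdot>\<^bsub>G\<^esub> b l)" if "x \<in> carrier G" for x
    using someI_ex[OF span[OF that]] unfolding m_def .
  have torsF: "[int p] \<cdot>\<^bsub>F\<^esub> \<one>\<^bsub>F\<^esub> = \<zero>\<^bsub>F\<^esub>"
    using assms(6) by (simp add: add_pow_def int_pow_int)
  have one: "[i] \<cdot>\<^bsub>F\<^esub> \<one>\<^bsub>F\<^esub> = [j] \<cdot>\<^bsub>F\<^esub> \<one>\<^bsub>F\<^esub>" if "int p dvd i - j" for i j :: int
  proof -
    have "[(i - j)] \<cdot>\<^bsub>F\<^esub> \<one>\<^bsub>F\<^esub> = \<zero>\<^bsub>F\<^esub>"
      using F.int_multiple_eq_0[OF F.one_closed torsF that] .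
    moreover have "[(i - j + j)] \<cdot>\<^bsub>F\<^esub> \<one>\<^bsub>F\<^esub> = [(i - j)] \<cdot>\<^bsub>F\<^esub> \<one>\<^bsub>F\<^esub> \<oplus>\<^bsub>F\<^esub> [j] \<cdot>\<^bsub>F\<^esub> \<one>\<^bsub>F\<^esub>"
      by (rule F.add.int_pow_mult) simp
    ultimately show ?thesis by simp
  qed
  \<comment> \<open>Two coefficient vectors of the same \<open>x\<close> differ by a relation of
    \<open>b\<close>, so by independence they agree modulo \<open>p\<close>. The arbitrary choice of
    \<open>m x\<close> therefore leaves no trace in \<open>F\<close>, which yields both additivity
    and duality of the coordinates.\<close>
  have unique: "[m x l] \<cdot>\<^bsub>F\<^esub> \<one>\<^bsub>F\<^esub> = [m' l] \<cdot>\<^bsub>F\<^esub> \<one>\<^bsub>F\<^esub>"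
    if x: "x \<in> carrier G" "x = (\<Oplus>\<^bsub>G\<^esub>l\<in>{..<d}. [m' l] \<cdot>\<^bsub>G\<^esub> b l)" and l: "l < d" for x l and m' :: "nat \<Rightarrow> int"
  proof -
    let ?sum = "\<lambda>n :: nat \<Rightarrow> int. \<Oplus>\<^bsub>G\<^esub>l\<in>{..<d}. [n l] \<cdot>\<^bsub>G\<^esub> b l"
    have x_m: "?sum (m x) = x" "?sum m' = x"
      by (rule m[OF x(1), symmetric], rule x(2)[symmetric])
    have "?sum (\<lambda>l. (- 1) * m' l) = [(- 1 :: int)] \<cdot>\<^bsub>G\<^esub> ?sum m'"
      using b by (intro G.finsum_int_multiple) simp
    then have neg: "?sum (\<lambda>l. (- 1) * m' l) = [(- 1 :: int)] \<cdot>\<^bsub>G\<^esub> x"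
      unfolding x_m .
    have "?sum (\<lambda>l. m x l + (- 1) * m' l) = ?sum (m x) \<oplus>\<^bsub>G\<^esub> ?sum (\<lambda>l. (- 1) * m' l)"
      using b by (intro G.finsum_int_add) simp
    also have "\<dots> = x \<oplus>\<^bsub>G\<^esub> [(- 1 :: int)] \<cdot>\<^bsub>G\<^esub> x"
      unfolding neg x_m ..
    also have "\<dots> = \<zero>\<^bsub>G\<^esub>"
      using x(1) G.add.int_pow_neg[of x 1] G.add.int_pow_1[of x] by (simp add: G.r_neg)
    finally have "int p dvd m x l + (- 1) * m' l"
      using l by (rule G.independent_modD[OF ind])
    then show ?thesis by (intro one) simp
  qed
  define \<kappa> where "\<kappa> l x = [m x l] \<cdot>\<^bsub>F\<^esub> \<one>\<^bsub>F\<^esub>" for l x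
  show thesis
  proof (rule that[of d b \<kappa>])
    show "\<kappa> l \<in> hom (add_monoid G) (add_monoid F)" if l: "l < d" for l
    proof (rule homI)
      fix x y assume "x \<in> carrier (add_monoid G)" "y \<in> carrier (add_monoid G)"
      then have xy: "x \<in> carrier G" "y \<in> carrier G" by auto
      have "x \<oplus>\<^bsub>G\<^esub> y = (\<Oplus>\<^bsub>G\<^esub>l\<in>{..<d}. [(m x l + m y l)] \<cdot>\<^bsub>G\<^esub> b l)"
        by (subst G.finsum_int_add) (simp_all add: b m[OF xy(1), symmetric] m[OF xy(2), symmetric])
      from unique[OF G.a_closed[OF xy] this l]
      have "\<kappa> l (x \<oplus>\<^bsub>G\<^esub> y) = [(m x l + m y l)] \<cdot>\<^bsub>F\<^esub> \<one>\<^bsub>F\<^esub>"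
        unfolding \<kappa>_def .
      then show "\<kappa> l (x \<otimes>\<^bsub>add_monoid G\<^esub> y) = \<kappa> l x \<otimes>\<^bsub>add_monoid F\<^esub> \<kappa> l y"
        by (simp add: \<kappa>_def F.add.int_pow_mult)
    qed (simp add: \<kappa>_def)
    show "\<kappa> l (b l') = (if l = l' then \<one>\<^bsub>F\<^esub> else \<zero>\<^bsub>F\<^esub>)" if l: "l < d" "l' < d" for l l'
    proof -
      have "(\<Oplus>\<^bsub>G\<^esub>l\<in>{..<d}. [(if l = l' then 1 else 0 :: int)] \<cdot>\<^bsub>G\<^esub> b l)
          = (\<Oplus>\<^bsub>G\<^esub>l\<in>{..<d}. if l' = l then b l else \<zero>\<^bsub>G\<^esub>)"
      proof (rule G.finsum_cong')
        fix i assume "i \<in> {..<d}"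
        then show "[(if i = l' then 1 else 0 :: int)] \<cdot>\<^bsub>G\<^esub> b i = (if l' = i then b i else \<zero>\<^bsub>G\<^esub>)"
          using b[of i] G.add.int_pow_1[of "b i"] by (auto simp: add_pow_def)
      qed (use b in auto)
      also have "\<dots> = b l'"
        using b l by (intro G.finsum_singleton) auto
      finally have "b l' = (\<Oplus>\<^bsub>G\<^esub>l\<in>{..<d}. [(if l = l' then 1 else 0 :: int)] \<cdot>\<^bsub>G\<^esub> b l)" ..
      from unique[OF b[OF l(2)] this l(1)]
      have "\<kappa> l (b l') = [(if l = l' then 1 else 0 :: int)] \<cdot>\<^bsub>F\<^esub> \<one>\<^bsub>F\<^esub>"
        unfolding \<kappa>_def .
      then show ?thesis
        using F.add.int_pow_1[of "\<one>\<^bsub>F\<^esub>"] by (cases "l = l'") (simp_all add: add_pow_def)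
    qed
    show "\<psi> v = (\<Oplus>\<^bsub>F\<^esub>l\<in>{..<d}. \<kappa> l v \<otimes>\<^bsub>F\<^esub> \<psi> (b l))"
      if \<psi>: "\<psi> \<in> hom (add_monoid G) (add_monoid F)" and v: "v \<in> carrier G" for \<psi> v
    proof -
      have closed: "\<psi> x \<in> carrier F" if "x \<in> carrier G" for x
        using hom_in_carrier[OF \<psi>] that by simp
      have "\<psi> v = \<psi> (\<Oplus>\<^bsub>G\<^esub>l\<in>{..<d}. [m v l] \<cdot>\<^bsub>G\<^esub> b l)"
        using arg_cong[OF m[OF v]] .
      also have "\<dots> = (\<Oplus>\<^bsub>F\<^esub>l\<in>{..<d}. \<psi> ([m v l] \<cdot>\<^bsub>G\<^esub> b l))"
        using b by (intro additive_finsum[OF assms(1) F.abelian_group_axioms \<psi>]) auto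
      \<comment> \<open>The integer factor passes through the additive map \<psi>, and the multiple
        of \<open>\<psi> (b l)\<close> by \<open>m v l\<close> is the product of
        \<open>\<kappa> l v\<close> with it.\<close>
      also have "\<dots> = (\<Oplus>\<^bsub>F\<^esub>l\<in>{..<d}. \<kappa> l v \<otimes>\<^bsub>F\<^esub> \<psi> (b l))"
        using b closed
        by (intro F.finsum_cong')
          (auto simp: \<kappa>_def F.add_pow_ldistr_int additive_int_pow[OF assms(1) F.abelian_group_axioms \<psi>])
      finally show ?thesis .
    qed
    show "d > 0" if "carrier G \<noteq> {\<zero>\<^bsub>G\<^esub>}"
    proof (rule ccontr)
      assume "\<not> d > 0"
      then have "x = \<zero>\<^bsub>G\<^esub>" if "x \<in> carrier G" for x
        using m[OF that, symmetric] by simp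
      then show False using that by auto
    qed
  qed (use b in auto)
qed

text \<open>Here \<open>b\<close> and \<kappa> are dual bases for the ideal \<open>V\<close>.
  Spanning is expressed by \<open>expansion\<close>, through additive maps into \<open>F\<close>,
  because functions with values in \<open>V\<close> are always read through some
  \<open>\<kappa> l\<close>.\<close>

locale ideal_coordinates = R: ring R + I: ideal V R + F: cring F
  for R :: "('a, 'r) ring_scheme" and V :: "'a set" and F :: "('b, 'f) ring_scheme" +
  fixes d :: nat and b :: "nat \<Rightarrow> 'a" and \<kappa> :: "nat \<Rightarrow> 'a \<Rightarrow> 'b"
  assumes b_in: "l < d \<Longrightarrow> b l \<in> V"
    and \<kappa>_hom: "l < d \<Longrightarrow> \<kappa> l \<in> hom (add_monoid (R\<lparr>carrier := V\<rparr>)) (add_monoid F)"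
    and \<kappa>_b: "l < d \<Longrightarrow> l' < d \<Longrightarrow> \<kappa> l (b l') = (if l = l' then \<one>\<^bsub>F\<^esub> else \<zero>\<^bsub>F\<^esub>)"
    and expansion: "\<psi> \<in> hom (add_monoid (R\<lparr>carrier := V\<rparr>)) (add_monoid F) \<Longrightarrow> v \<in> V \<Longrightarrow>
      \<psi> v = (\<Oplus>\<^bsub>F\<^esub>l\<in>{..<d}. \<kappa> l v \<otimes>\<^bsub>F\<^esub> \<psi> (b l))"

section \<open>Two-sided linear functions on an ideal\<close>

lemma (in ideal) abelian_group_restrict: "abelian_group (R\<lparr>carrier := I\<rparr>)"
proof (rule abelian_groupI)
  fix x assume "x \<in> carrier (R\<lparr>carrier := I\<rparr>)"
  then show "\<exists>y\<in>carrier (R\<lparr>carrier := I\<rparr>). y \<oplus>\<^bsub>R\<lparr>carrier := I\<rparr>\<^esub> x = \<zero>\<^bsub>R\<lparr>carrier := I\<rparr>\<^esub>"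
    by (intro bexI[of _ "\<ominus> x"]) (auto simp: l_neg Icarr)
qed (auto simp: a_ac Icarr)

lemma (in ideal) finsum_restrict:
  assumes "f \<in> A \<rightarrow> I"
  shows "finsum (R\<lparr>carrier := I\<rparr>) f A = finsum R f A" and "finsum R f A \<in> I"
proof -
  interpret G: abelian_group "R\<lparr>carrier := I\<rparr>" by (rule abelian_group_restrict)
  have "finsum (R\<lparr>carrier := I\<rparr>) f A = finsum R f A \<and> finsum R f A \<in> I"
    using assms
  proof (induction A rule: infinite_finite_induct)
    case (insert a A)
    then have "f a \<in> carrier R" "\<forall>x\<in>A. f x \<in> carrier R" by (auto intro!: Icarr)
    then show ?case using insert by (auto simp: Pi_def)
  qed (auto simp: finsum_infinite)
  then show "finsum (R\<lparr>carrier := I\<rparr>) f A = finsum R f A" and "finsum R f A \<in> I" by auto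
qed

text \<open>Evaluation at these inputs recovers the part of a two-sided linear function that depends
  on one variable. Matrix entries can thus be defined from the function alone, without choosing
  coefficients.\<close>

definition single :: "('a, 'r) ring_scheme \<Rightarrow> 'i set \<Rightarrow> 'i \<Rightarrow> 'a \<Rightarrow> 'i \<Rightarrow> 'a" where
  "single R I i v = (\<lambda>j\<in>I. if j = i then v else \<zero>\<^bsub>R\<^esub>)"

text \<open>The summands belonging to variable \<open>i\<close> are collected into one map
  \<open>T i\<close>. Distributivity makes it additive, and it preserves every two-sided ideal
  because such ideals absorb factors on both sides.\<close>

lemma (in ring) two_sided_linear_terms:
  fixes I :: "'i set"
  assumes "two_sided_linear R I f" "finite I"
  obtains T where "\<And>i v. i \<in> I \<Longrightarrow> v \<in> carrier R \<Longrightarrow> T i v \<in> carrier R"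
    and "\<And>i v w. i \<in> I \<Longrightarrow> v \<in> carrier R \<Longrightarrow> w \<in> carrier R \<Longrightarrow> T i (v \<oplus> w) = T i v \<oplus> T i w"
    and "\<And>i v V. i \<in> I \<Longrightarrow> ideal V R \<Longrightarrow> v \<in> V \<Longrightarrow> T i v \<in> V"
    and "\<And>x. x \<in> I \<rightarrow>\<^sub>E carrier R \<Longrightarrow> f x = (\<Oplus>i\<in>I. T i (x i))"
proof -
  obtain t :: "'i \<Rightarrow> nat" and a b
    where ab: "\<And>i j. i \<in> I \<Longrightarrow> j < t i \<Longrightarrow> a i j \<in> carrier R \<and> b i j \<in> carrier R"
      and f: "\<And>x. x \<in> I \<rightarrow>\<^sub>E carrier R \<Longrightarrow>
        f x = (\<Oplus>i\<in>I. \<Oplus>j\<in>{..<t i}. a i j \<otimes> x i \<otimes> b i j)"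
    using assms(1) unfolding two_sided_linear_def by blast
  define T where "T i v = (\<Oplus>j\<in>{..<t i}. a i j \<otimes> v \<otimes> b i j)" for i v
  show thesis
  proof (rule that[of T])
    show "T i v \<in> carrier R" if "i \<in> I" "v \<in> carrier R" for i v
      using ab that by (auto simp: T_def)
    show "T i (v \<oplus> w) = T i v \<oplus> T i w" if "i \<in> I" "v \<in> carrier R" "w \<in> carrier R" for i v w
    proof -
      have "T i v \<oplus> T i w = (\<Oplus>j\<in>{..<t i}. a i j \<otimes> v \<otimes> b i j \<oplus> a i j \<otimes> w \<otimes> b i j)"
        unfolding T_def using ab that by (intro finsum_addf[symmetric]) auto
      also have "\<dots> = T i (v \<oplus> w)"
        unfolding T_def using ab that by (intro finsum_cong') (auto simp: l_distr r_distr)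
      finally show ?thesis by simp
    qed
    show "T i v \<in> V" if "i \<in> I" "ideal V R" "v \<in> V" for i v V
    proof -
      interpret V: ideal V R by fact
      show ?thesis
        unfolding T_def using ab that
        by (intro V.finsum_restrict(2)) (auto simp: V.I_l_closed V.I_r_closed)
    qed
  qed (simp add: f T_def)
qed

section \<open>Matrices in coordinates and superposition\<close>

context ideal_coordinates
begin

abbreviation "G \<equiv> R\<lparr>carrier := V\<rparr>"

lemma abelian_group_G: "abelian_group G"
  by (rule I.abelian_group_restrict)

lemma \<kappa>_closed: "l < d \<Longrightarrow> v \<in> V \<Longrightarrow> \<kappa> l v \<in> carrier F"
  using hom_in_carrier[OF \<kappa>_hom] by simp

lemma \<kappa>_finsum:
  assumes "l < d" "f \<in> A \<rightarrow> V"
  shows "\<kappa> l (\<Oplus>\<^bsub>R\<^esub>a\<in>A. f a) = (\<Oplus>\<^bsub>F\<^esub>a\<in>A. \<kappa> l (f a))"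
  using additive_finsum[OF abelian_group_G F.abelian_group_axioms \<kappa>_hom[OF assms(1)], of f A] assms
  by (simp add: I.finsum_restrict(1)[OF assms(2)])

lemma single_in: "v \<in> V \<Longrightarrow> single R I i v \<in> I \<rightarrow>\<^sub>E V"
  by (auto simp: single_def)

text \<open>Each \<open>T j\<close> vanishes at zero, so the value of \<open>f\<close> at
  \<open>single R I i v\<close> is just \<open>T i v\<close>. The properties of the maps
  \<open>T i\<close> on \<open>V\<close> then become properties of \<open>f\<close>.\<close>

lemma two_sided_linear_single:
  assumes tsl: "two_sided_linear R I f" and "finite I"
  shows "i \<in> I \<Longrightarrow> (\<lambda>v. f (single R I i v)) \<in> hom (add_monoid G) (add_monoid G)"
    and "x \<in> I \<rightarrow>\<^sub>E V \<Longrightarrow> f x = (\<Oplus>\<^bsub>R\<^esub>i\<in>I. f (single R I i (x i)))"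
    and "x \<in> I \<rightarrow>\<^sub>E V \<Longrightarrow> f x \<in> V"
proof -
  obtain T where T: "\<And>i v. i \<in> I \<Longrightarrow> v \<in> carrier R \<Longrightarrow> T i v \<in> carrier R"
      "\<And>i v w. i \<in> I \<Longrightarrow> v \<in> carrier R \<Longrightarrow> w \<in> carrier R \<Longrightarrow> T i (v \<oplus>\<^bsub>R\<^esub> w) = T i v \<oplus>\<^bsub>R\<^esub> T i w"
      "\<And>i v V. i \<in> I \<Longrightarrow> ideal V R \<Longrightarrow> v \<in> V \<Longrightarrow> T i v \<in> V"
      "\<And>x. x \<in> I \<rightarrow>\<^sub>E carrier R \<Longrightarrow> f x = (\<Oplus>\<^bsub>R\<^esub>i\<in>I. T i (x i))"
    by (rule R.two_sided_linear_terms[OF tsl assms(2)]) blast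
  have T_V: "T i v \<in> V" if "i \<in> I" "v \<in> V" for i v
    using T(3)[OF that(1) I.ideal_axioms that(2)] .
  have T_0: "T i \<zero>\<^bsub>R\<^esub> = \<zero>\<^bsub>R\<^esub>" if "i \<in> I" for i
    using T(2)[OF that, of "\<zero>\<^bsub>R\<^esub>" "\<zero>\<^bsub>R\<^esub>"] T(1)[OF that, of "\<zero>\<^bsub>R\<^esub>"] by simp
  have f_V: "f x = (\<Oplus>\<^bsub>R\<^esub>i\<in>I. T i (x i))" if "x \<in> I \<rightarrow>\<^sub>E V" for x
    using T(4) that I.Icarr by (auto simp: PiE_iff)
  have f_single: "f (single R I i v) = T i v" if "i \<in> I" "v \<in> V" for i v
  proof -
    have "f (single R I i v) = (\<Oplus>\<^bsub>R\<^esub>j\<in>I. T j (single R I i v j))"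
      using that by (intro f_V single_in)
    also have "\<dots> = (\<Oplus>\<^bsub>R\<^esub>j\<in>I. if i = j then T j v else \<zero>\<^bsub>R\<^esub>)"
      using that T(1) I.Icarr by (intro R.finsum_cong') (auto simp: single_def T_0)
    also have "\<dots> = T i v"
      using that T(1) I.Icarr assms(2) by (intro R.finsum_singleton) auto
    finally show ?thesis .
  qed
  show "(\<lambda>v. f (single R I i v)) \<in> hom (add_monoid G) (add_monoid G)" if "i \<in> I"
    using that T_V T(2) I.Icarr by (intro homI) (auto simp: f_single)
  show "f x = (\<Oplus>\<^bsub>R\<^esub>i\<in>I. f (single R I i (x i)))" if "x \<in> I \<rightarrow>\<^sub>E V"
    unfolding f_V[OF that] using that T(1) I.Icarr
    by (intro R.finsum_cong') (auto simp: f_single PiE_iff)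
  show "f x \<in> V" if "x \<in> I \<rightarrow>\<^sub>E V"
    unfolding f_V[OF that] using that T_V by (intro I.finsum_restrict(2)) (auto simp: PiE_iff)
qed

text \<open>The matrix of \<open>f\<close> on \<open>V\<close> in the coordinates given by
  \<open>b\<close> and \<kappa>: \<open>l\<close> is the row, and the column \<open>q\<close>
  consists of a variable and the index of a basis vector.\<close>

definition matrix_entry :: "'i set \<Rightarrow> (('i \<Rightarrow> 'a) \<Rightarrow> 'a) \<Rightarrow> nat \<Rightarrow> 'i \<times> nat \<Rightarrow> 'b" where
  "matrix_entry I f l q = \<kappa> l (f (single R I (fst q) (b (snd q))))"

lemma matrix_entry_closed:
  assumes "two_sided_linear R I f" "finite I" "l < d" "q \<in> I \<times> {..<d}"
  shows "matrix_entry I f l q \<in> carrier F"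
  using assms b_in two_sided_linear_single(3)[OF assms(1,2) single_in]
  by (auto simp: matrix_entry_def intro!: \<kappa>_closed)

text \<open>For fixed \<open>i\<close> the map taking \<open>v\<close> to
  \<open>\<kappa> l (f (single R I i v))\<close> is additive from \<open>V\<close> to
  \<open>F\<close>, so \<open>expansion\<close> applies to it. Summing over \<open>i\<close> gives
  multiplication by the matrix.\<close>

lemma \<kappa>_two_sided_linear:
  assumes tsl: "two_sided_linear R I f" "finite I" and l: "l < d" and x: "x \<in> I \<rightarrow>\<^sub>E V"
  shows "\<kappa> l (f x) =
    (\<Oplus>\<^bsub>F\<^esub>q\<in>I \<times> {..<d}. \<kappa> (snd q) (x (fst q)) \<otimes>\<^bsub>F\<^esub> matrix_entry I f l q)"
proof -
  have x_in: "x i \<in> V" if "i \<in> I" for i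
    using x that by auto
  have term_in: "f (single R I i (x i)) \<in> V" if "i \<in> I" for i
    using two_sided_linear_single(3)[OF tsl single_in] x_in[OF that] .
  have "\<kappa> l (f x) = \<kappa> l (\<Oplus>\<^bsub>R\<^esub>i\<in>I. f (single R I i (x i)))"
    using two_sided_linear_single(2)[OF tsl x] by simp
  also have "\<dots> = (\<Oplus>\<^bsub>F\<^esub>i\<in>I. \<kappa> l (f (single R I i (x i))))"
    using l term_in by (intro \<kappa>_finsum) auto
  also have "\<dots> = (\<Oplus>\<^bsub>F\<^esub>i\<in>I. \<Oplus>\<^bsub>F\<^esub>l'\<in>{..<d}. \<kappa> l' (x i) \<otimes>\<^bsub>F\<^esub> matrix_entry I f l (i, l'))"
  proof (rule F.finsum_cong')
    fix i assume i: "i \<in> I"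
    have "(\<lambda>v. \<kappa> l (f (single R I i v))) \<in> hom (add_monoid G) (add_monoid F)"
      using hom_compose[OF two_sided_linear_single(1)[OF tsl i] \<kappa>_hom[OF l]] by (simp add: o_def)
    from expansion[OF this x_in[OF i]]
    show "\<kappa> l (f (single R I i (x i))) =
        (\<Oplus>\<^bsub>F\<^esub>l'\<in>{..<d}. \<kappa> l' (x i) \<otimes>\<^bsub>F\<^esub> matrix_entry I f l (i, l'))"
      by (simp add: matrix_entry_def)
  qed (use matrix_entry_closed[OF tsl l] \<kappa>_closed x_in in auto)
  also have "\<dots> = (\<Oplus>\<^bsub>F\<^esub>q\<in>I \<times> {..<d}. \<kappa> (snd q) (x (fst q)) \<otimes>\<^bsub>F\<^esub> matrix_entry I f l (fst q, snd q))"
    using matrix_entry_closed[OF tsl l] \<kappa>_closed x_in tsl(2) by (intro F.finsum_times[symmetric]) auto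
  finally show ?thesis by simp
qed

text \<open>The function over \<open>F\<close> with the same matrix as \<open>f\<close>. The set
  \<open>J\<close> indexes the components of the longer input vectors, and \<beta> translates such a
  component into a variable of \<open>f\<close> together with a coordinate.\<close>

definition lift :: "'j set \<Rightarrow> ('j \<Rightarrow> 'i \<times> nat) \<Rightarrow> 'i set \<Rightarrow> (('i \<Rightarrow> 'a) \<Rightarrow> 'a) \<Rightarrow> nat \<Rightarrow> ('j \<Rightarrow> 'b) \<Rightarrow> 'b"
  where "lift J \<beta> I f l x = (\<Oplus>\<^bsub>F\<^esub>q\<in>J. x q \<otimes>\<^bsub>F\<^esub> matrix_entry I f l (\<beta> q))"

lemma lift_closed:
  assumes "two_sided_linear R I f" "finite I" "l < d" "\<beta> \<in> J \<rightarrow> I \<times> {..<d}" "x \<in> J \<rightarrow> carrier F"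
  shows "lift J \<beta> I f l x \<in> carrier F"
  unfolding lift_def using assms matrix_entry_closed[OF assms(1-3)]
  by (intro F.finsum_closed) (auto simp: Pi_iff)

lemma two_sided_linear_lift:
  assumes "two_sided_linear R I f" "finite I" "l < d" "\<beta> \<in> J \<rightarrow> I \<times> {..<d}"
  shows "two_sided_linear F J (lift J \<beta> I f l)"
proof -
  have M: "matrix_entry I f l (\<beta> q) \<in> carrier F" if "q \<in> J" for q
    using matrix_entry_closed[OF assms(1-3), of "\<beta> q"] funcset_mem[OF assms(4) that] by simp
  \<comment> \<open>One summand per variable is enough: the left factor is one and the right factor
    is the matrix entry.\<close>
  have "lift J \<beta> I f l x =
      (\<Oplus>\<^bsub>F\<^esub>q\<in>J. \<Oplus>\<^bsub>F\<^esub>j\<in>{..<Suc 0}. \<one>\<^bsub>F\<^esub> \<otimes>\<^bsub>F\<^esub> x q \<otimes>\<^bsub>F\<^esub> matrix_entry I f l (\<beta> q))"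
    if "x \<in> J \<rightarrow>\<^sub>E carrier F" for x
    unfolding lift_def using that M by (intro F.finsum_cong') (auto simp: lessThan_Suc PiE_iff)
  then show ?thesis
    unfolding two_sided_linear_def using M
    by (intro exI[of _ "\<lambda>_. Suc 0"] exI[of _ "\<lambda>_ _. \<one>\<^bsub>F\<^esub>"]
        exI[of _ "\<lambda>q _. matrix_entry I f l (\<beta> q)"] conjI ballI allI impI) auto
qed

text \<open>The input \<open>x\<close> combines the coordinate vectors of the inputs
  \<open>X c\<close>, each scalar \<open>c\<close> being both index and weight. The lift acts on
  each coordinate vector as \<open>f\<close> acts on \<open>X c\<close>, so exchanging the sums over
  \<open>J\<close> and \<open>C\<close> gives the same combination of outputs.\<close>

lemma lift_superposition:
  assumes tsl: "two_sided_linear R I f" "finite I" and l: "l < d"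
    and \<beta>: "bij_betw \<beta> J (I \<times> {..<d})" and C: "finite C" "C \<subseteq> carrier F"
    and X: "\<And>c. c \<in> C \<Longrightarrow> X c \<in> I \<rightarrow>\<^sub>E V"
    and x: "\<And>q. q \<in> J \<Longrightarrow> x q = (\<Oplus>\<^bsub>F\<^esub>c\<in>C. c \<otimes>\<^bsub>F\<^esub> \<kappa> (snd (\<beta> q)) (X c (fst (\<beta> q))))"
  shows "lift J \<beta> I f l x = (\<Oplus>\<^bsub>F\<^esub>c\<in>C. c \<otimes>\<^bsub>F\<^esub> \<kappa> l (f (X c)))"
proof -
  let ?M = "\<lambda>q. matrix_entry I f l (\<beta> q)"
  let ?K = "\<lambda>c q. \<kappa> (snd (\<beta> q)) (X c (fst (\<beta> q)))"
  have \<beta>_in: "fst (\<beta> q) \<in> I" "snd (\<beta> q) < d" if "q \<in> J" for q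
    using bij_betwE[OF \<beta>] that by auto
  have J: "finite J"
    using bij_betw_finite[OF \<beta>] tsl(2) by simp
  have M: "?M q \<in> carrier F" if "q \<in> J" for q
    using matrix_entry_closed[OF tsl l] bij_betwE[OF \<beta>] that by auto
  have K: "?K c q \<in> carrier F" if "q \<in> J" "c \<in> C" for q c
    using \<beta>_in[OF that(1)] X[OF that(2)] by (intro \<kappa>_closed) auto
  have C': "c \<in> carrier F" if "c \<in> C" for c using C that by auto
  have "lift J \<beta> I f l x = (\<Oplus>\<^bsub>F\<^esub>q\<in>J. \<Oplus>\<^bsub>F\<^esub>c\<in>C. c \<otimes>\<^bsub>F\<^esub> ?K c q \<otimes>\<^bsub>F\<^esub> ?M q)"
    unfolding lift_def using M K C' C(1)
    by (intro F.finsum_cong') (auto simp: x F.finsum_ldistr)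
  also have "\<dots> = (\<Oplus>\<^bsub>F\<^esub>c\<in>C. \<Oplus>\<^bsub>F\<^esub>q\<in>J. c \<otimes>\<^bsub>F\<^esub> ?K c q \<otimes>\<^bsub>F\<^esub> ?M q)"
    using M K C' C(1) J by (intro F.finsum_swap) auto
  also have "\<dots> = (\<Oplus>\<^bsub>F\<^esub>c\<in>C. c \<otimes>\<^bsub>F\<^esub> \<kappa> l (f (X c)))"
  proof (rule F.finsum_cong')
    fix c assume c: "c \<in> C"
    have "\<kappa> l (f (X c)) = (\<Oplus>\<^bsub>F\<^esub>q\<in>\<beta> ` J. \<kappa> (snd q) (X c (fst q)) \<otimes>\<^bsub>F\<^esub> matrix_entry I f l q)"
      using \<kappa>_two_sided_linear[OF tsl l X[OF c]] bij_betw_imp_surj_on[OF \<beta>] by simp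
    also have "\<dots> = (\<Oplus>\<^bsub>F\<^esub>q\<in>J. ?K c q \<otimes>\<^bsub>F\<^esub> ?M q)"
      using M K c bij_betw_imp_inj_on[OF \<beta>] by (intro F.finsum_reindex) auto
    finally show "(\<Oplus>\<^bsub>F\<^esub>q\<in>J. c \<otimes>\<^bsub>F\<^esub> ?K c q \<otimes>\<^bsub>F\<^esub> ?M q) = c \<otimes>\<^bsub>F\<^esub> \<kappa> l (f (X c))"
      using M K c C' J by (auto simp: F.finsum_rdistr F.m_assoc intro!: F.finsum_cong')
  next
    show "(\<lambda>c. c \<otimes>\<^bsub>F\<^esub> \<kappa> l (f (X c))) \<in> C \<rightarrow> carrier F"
      using C' \<kappa>_closed[OF l two_sided_linear_single(3)[OF tsl X]] by auto
  qed simp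
  finally show ?thesis .
qed

end

section \<open>Transfer of a solution from \<open>R\<close> to \<open>F\<close>\<close>

lemma input_length_times: "input_length (\<lambda>i. k i * d) (n * d) s = input_length k n s * d"
  by (cases s) auto

text \<open>
  The new block lengths are the old ones times \<open>d\<close>: component \<open>j * d + l\<close> of a vector over \<open>F\<close>
  is the \<open>l\<close>-th coordinate of component \<open>j\<close> of a vector over \<open>V\<close>.
\<close>

definition split_component :: "nat \<Rightarrow> 's \<times> nat \<Rightarrow> ('s \<times> nat) \<times> nat" where
  "split_component d q = ((fst q, snd q div d), snd q mod d)"

text \<open>Division with remainder by \<open>d\<close>; the inverse recombines quotient and
  remainder.\<close>

lemma bij_betw_split_component:
  assumes "d > 0"
  shows "bij_betw (split_component d) (input_components N (\<lambda>i. k i * d) (n * d) v)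
    (input_components N k n v \<times> {..<d})"
proof (rule bij_betwI[where g = "\<lambda>q. (fst (fst q), snd (fst q) * d + snd q)"])
  have "c * d + l < m * d" if "c < m" "l < d" for c l m :: nat
  proof -
    have "c * d + l < Suc c * d" using that by simp
    also have "\<dots> \<le> m * d" using that by (intro mult_le_mono) auto
    finally show ?thesis .
  qed
  then show "(\<lambda>q. (fst (fst q), snd (fst q) * d + snd q)) \<in> input_components N k n v \<times> {..<d}
      \<rightarrow> input_components N (\<lambda>i. k i * d) (n * d) v"
    by (auto simp: input_components_def input_length_times)
qed (use assms in \<open>auto simp: input_components_def input_length_times split_component_def
  less_mult_imp_div_less\<close>)

lemma (in network) finite_input_components: "finite (input_components N k n v)"
proof -
  have "finite (in_arcs (net_graph N) v)"
    by (rule finite_subset[of _ "arcs (net_graph N)"]) auto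
  then show ?thesis by (auto simp: input_components_def inputs_def)
qed

text \<open>Every component function is replaced by the lifts of its \<open>d\<close> coordinates. A
  message over \<open>F\<close> is decomposed into messages \<open>u c\<close> over
  \<open>V\<close>; superposition propagates this decomposition through the network, and decoding
  each \<open>u c\<close> over \<open>R\<close> recovers the message. Rates are preserved because
  all block lengths grow by the factor \<open>d\<close>.\<close>

lemma (in ideal_coordinates) linearly_achievable_transfer:
  assumes N: "network N" and d: "d > 0" and F: "finite (carrier F)" "card (carrier F) \<ge> 2"
    and lin: "two_sided_linear_code N R k n ef df" and sol: "is_solution N (carrier R) k n ef df"
  shows "linearly_achievable N F (rate_vector N k n)"
proof -
  interpret N: network N by fact
  let ?G = "net_graph N"
  let ?\<beta> = "split_component d"
  define k' where "k' i = k i * d" for i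
  define n' where "n' = n * d"
  define IC where "IC = input_components N k n"
  define IC' where "IC' = input_components N k' n'"
  define ef' where "ef' e x =
    (\<lambda>j\<in>{..<n'}. lift (IC' (tail ?G e)) ?\<beta> (IC (tail ?G e)) (\<lambda>y. ef e y (j div d)) (j mod d) x)" for e x
  define df' where "df' v i x =
    (\<lambda>j\<in>{..<k' i}. lift (IC' v) ?\<beta> (IC v) (\<lambda>y. df v i y (j div d)) (j mod d) x)" for v i x
  have n: "n \<ge> 1" using sol by (simp add: is_solution_def is_code_def)
  have fin: "finite (IC v)" for v
    unfolding IC_def by (rule N.finite_input_components)
  have \<beta>: "bij_betw ?\<beta> (IC' v) (IC v \<times> {..<d})" for v
    unfolding IC_def IC'_def k'_def n'_def using bij_betw_split_component[OF d] .
  then have \<beta>_in: "?\<beta> \<in> IC' v \<rightarrow> IC v \<times> {..<d}" for v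
    by (rule bij_betw_imp_funcset)
  have mod: "j mod d < d" for j using d by simp
  have ef_lin: "two_sided_linear R (IC (tail ?G e)) (\<lambda>y. ef e y (j div d))"
    if "e \<in> arcs ?G" "j < n'" for e j
    using lin that d by (auto simp: two_sided_linear_code_def IC_def n'_def less_mult_imp_div_less)
  have df_lin: "two_sided_linear R (IC v) (\<lambda>y. df v i y (j div d))"
    if "v \<in> receivers N" "i \<in> demands N v" "j < k' i" for v i j
    using lin that d by (auto simp: two_sided_linear_code_def IC_def k'_def less_mult_imp_div_less)
  have code: "is_code N (carrier F) k' n' ef' df'"
    unfolding is_code_def
  proof (intro conjI ballI)
    show "1 \<le> n'" using n d by (simp add: n'_def)
    show "ef' e \<in> (input_components N k' n' (tail ?G e) \<rightarrow>\<^sub>E carrier F) \<rightarrow> ({..<n'} \<rightarrow>\<^sub>E carrier F)"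
      if "e \<in> arcs ?G" for e
      unfolding IC'_def[symmetric] ef'_def
      using lift_closed[OF ef_lin[OF that] fin mod \<beta>_in]
      by (intro Pi_I restrict_PiE_iff[THEN iffD2] ballI) (auto simp: PiE_iff)
    show "df' v i \<in> (input_components N k' n' v \<rightarrow>\<^sub>E carrier F) \<rightarrow> ({..<k' i} \<rightarrow>\<^sub>E carrier F)"
      if "v \<in> receivers N" "i \<in> demands N v" for v i
      unfolding IC'_def[symmetric] df'_def
      using lift_closed[OF df_lin[OF that] fin mod \<beta>_in]
      by (intro Pi_I restrict_PiE_iff[THEN iffD2] ballI) (auto simp: PiE_iff)
  qed (use F in auto)
  have lin': "two_sided_linear_code N F k' n' ef' df'"
    unfolding two_sided_linear_code_def IC'_def[symmetric]
  proof (intro conjI ballI allI impI)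
    show "two_sided_linear F (IC' (tail ?G e)) (\<lambda>x. ef' e x j)" if "e \<in> arcs ?G" "j < n'" for e j
      using two_sided_linear_lift[OF ef_lin[OF that] fin mod \<beta>_in] that by (simp add: ef'_def)
    show "two_sided_linear F (IC' v) (\<lambda>x. df' v i x j)"
      if "v \<in> receivers N" "i \<in> demands N v" "j < k' i" for v i j
      using two_sided_linear_lift[OF df_lin[OF that] fin mod \<beta>_in] that by (simp add: df'_def)
  qed (rule code)
  have "df' v i (node_inputs N k' n' v w z) = w i"
    if w: "w \<in> (\<Pi>\<^sub>E i\<in>{..<num_msgs N}. {..<k' i} \<rightarrow>\<^sub>E carrier F)" and z: "carried N k' n' ef' w z"
      and v: "v \<in> receivers N" and i: "i \<in> demands N v" for w z v i
  proof -
    \<comment> \<open>\<open>w\<close> is the sum over \<open>c \<in> F\<close> of \<open>c\<close> times the coordinates of \<open>u c\<close>, where the coordinates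
      of \<open>u c\<close> form the indicator of the positions at which \<open>w\<close> has the value \<open>c\<close>.\<close>
    define u where "u c = (\<lambda>i\<in>{..<num_msgs N}. \<lambda>j\<in>{..<k i}.
      \<Oplus>\<^bsub>R\<^esub>l\<in>{..<d}. if w i (j * d + l) = c then b l else \<zero>\<^bsub>R\<^esub>)" for c
    define y where "y c = (SOME y. carried N k n ef (u c) y)" for c
    let ?in = "\<lambda>v c. node_inputs N k n v (u c) (y c)"
    have y: "carried N k n ef (u c) (y c)" for c
      unfolding y_def using N.carried_unique by (intro someI_ex[of "carried N k n ef (u c)"]) blast
    have u_V: "u c \<in> (\<Pi>\<^sub>E i\<in>{..<num_msgs N}. {..<k i} \<rightarrow>\<^sub>E V)" for c
      unfolding u_def
      by (intro restrict_PiE_iff[THEN iffD2] ballI I.finsum_restrict(2)) (auto simp: b_in)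
    then have u_R: "u c \<in> (\<Pi>\<^sub>E i\<in>{..<num_msgs N}. {..<k i} \<rightarrow>\<^sub>E carrier R)" for c
      by (simp add: PiE_iff I.Icarr)
    have in_V: "?in v c \<in> IC v \<rightarrow>\<^sub>E V"
      if "\<And>e j. e \<in> in_arcs ?G v \<Longrightarrow> j < n \<Longrightarrow> y c e j \<in> V" for v c
      using that u_V[of c]
      by (auto simp: node_inputs_def IC_def input_components_def inputs_def PiE_iff)
    \<comment> \<open>Two-sided linear functions preserve \<open>V\<close>, so by induction along
      the arcs all vectors carried for the messages \<open>u c\<close> stay in \<open>V\<close>,
      where coordinates make sense.\<close>
    have y_V: "e \<in> arcs ?G \<longrightarrow> (\<forall>j<n. y c e j \<in> V)" for e c
    proof (induction e rule: wf_induct_rule[OF N.wf_arcs])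
      case (1 e)
      show ?case
      proof (intro impI allI)
        fix j assume e: "e \<in> arcs ?G" and j: "j < n"
        have "?in (tail ?G e) c \<in> IC (tail ?G e) \<rightarrow>\<^sub>E V"
          by (rule in_V) (use 1 e in auto)
        moreover have "two_sided_linear R (IC (tail ?G e)) (\<lambda>y. ef e y j)"
          using lin e j by (auto simp: two_sided_linear_code_def IC_def)
        ultimately have "ef e (?in (tail ?G e) c) j \<in> V"
          using two_sided_linear_single(3)[OF _ fin] by blast
        then show "y c e j \<in> V"
          using y[of c] e by (simp add: carried_def)
      qed
    qed
    have in_V': "?in v c \<in> IC v \<rightarrow>\<^sub>E V" for v c
      by (rule in_V) (use y_V in auto)
    have w_eq: "w i j = (\<Oplus>\<^bsub>F\<^esub>c\<in>carrier F. c \<otimes>\<^bsub>F\<^esub> \<kappa> (j mod d) (u c i (j div d)))"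
      if i: "i < num_msgs N" and j: "j < k' i" for i j
    proof -
      have w_j: "w i j \<in> carrier F" using w i j by (auto simp: PiE_iff)
      have jd: "j div d < k i" using j d by (simp add: k'_def less_mult_imp_div_less)
      \<comment> \<open>The value at zero comes from additivity applied to the empty sum.\<close>
      have \<kappa>_0: "\<kappa> (j mod d) \<zero>\<^bsub>R\<^esub> = \<zero>\<^bsub>F\<^esub>"
        using \<kappa>_finsum[OF mod, of "\<lambda>_. \<zero>\<^bsub>R\<^esub>" "{}"] by simp
      \<comment> \<open>By duality only \<open>l = j mod d\<close> can contribute, and for it
        \<open>j div d * d + l\<close> is \<open>j\<close>.\<close>
      have "\<kappa> (j mod d) (u c i (j div d)) = (if w i j = c then \<one>\<^bsub>F\<^esub> else \<zero>\<^bsub>F\<^esub>)" for c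
      proof -
        have u_eq: "u c i (j div d) = (\<Oplus>\<^bsub>R\<^esub>l\<in>{..<d}. if w i (j div d * d + l) = c then b l else \<zero>\<^bsub>R\<^esub>)"
          using i jd by (simp add: u_def)
        have "\<kappa> (j mod d) (u c i (j div d)) =
            (\<Oplus>\<^bsub>F\<^esub>l\<in>{..<d}. \<kappa> (j mod d) (if w i (j div d * d + l) = c then b l else \<zero>\<^bsub>R\<^esub>))"
          unfolding u_eq by (intro \<kappa>_finsum mod) (simp add: b_in)
        also have "\<dots> = (\<Oplus>\<^bsub>F\<^esub>l\<in>{..<d}. if j mod d = l then if w i j = c then \<one>\<^bsub>F\<^esub> else \<zero>\<^bsub>F\<^esub> else \<zero>\<^bsub>F\<^esub>)"
        proof (rule F.finsum_cong')
          fix l assume "l \<in> {..<d}"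
          then show "\<kappa> (j mod d) (if w i (j div d * d + l) = c then b l else \<zero>\<^bsub>R\<^esub>) =
              (if j mod d = l then if w i j = c then \<one>\<^bsub>F\<^esub> else \<zero>\<^bsub>F\<^esub> else \<zero>\<^bsub>F\<^esub>)"
            using \<kappa>_b[OF mod[of j], of l] \<kappa>_0
            by (cases "w i (j div d * d + l) = c"; cases "j mod d = l") auto
        qed auto
        also have "\<dots> = (if w i j = c then \<one>\<^bsub>F\<^esub> else \<zero>\<^bsub>F\<^esub>)"
          using mod[of j] by (intro F.finsum_singleton) auto
        finally show ?thesis .
      qed
      then have "(\<Oplus>\<^bsub>F\<^esub>c\<in>carrier F. c \<otimes>\<^bsub>F\<^esub> \<kappa> (j mod d) (u c i (j div d)))
          = (\<Oplus>\<^bsub>F\<^esub>c\<in>carrier F. if w i j = c then c else \<zero>\<^bsub>F\<^esub>)"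
        by (intro F.finsum_cong') auto
      also have "\<dots> = w i j"
        using w_j F by (intro F.finsum_singleton) auto
      finally show ?thesis ..
    qed
    \<comment> \<open>Superposition passes from the incoming edges of a node to all its inputs; on
      message components it is \<open>w_eq\<close>.\<close>
    have node: "node_inputs N k' n' v w z q =
        (\<Oplus>\<^bsub>F\<^esub>c\<in>carrier F. c \<otimes>\<^bsub>F\<^esub> \<kappa> (snd (?\<beta> q)) (?in v c (fst (?\<beta> q))))"
      if IH: "\<And>e j. e \<in> in_arcs ?G v \<Longrightarrow> j < n' \<Longrightarrow>
          z e j = (\<Oplus>\<^bsub>F\<^esub>c\<in>carrier F. c \<otimes>\<^bsub>F\<^esub> \<kappa> (j mod d) (y c e (j div d)))"
        and q: "q \<in> IC' v" for v q
    proof -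
      obtain s j where sj: "q = (s, j)" by (cases q)
      have comp: "(s, j) \<in> input_components N k' n' v" "(s, j div d) \<in> input_components N k n v"
        using q funcset_mem[OF \<beta>_in q] by (auto simp: sj IC'_def IC_def split_component_def)
      show ?thesis
      proof (cases s)
        case (Msg i)
        then have "i < num_msgs N" "j < k' i"
          using comp by (auto simp: input_components_def inputs_def)
        then show ?thesis
          using comp w_eq Msg by (simp add: sj node_inputs_def split_component_def)
      next
        case (Arc e)
        then have "e \<in> in_arcs ?G v" "j < n'"
          using comp by (auto simp: input_components_def inputs_def)
        then show ?thesis
          using comp IH Arc by (simp add: sj node_inputs_def split_component_def)
      qed
    qed
    \<comment> \<open>Each edge over \<open>F\<close> carries the combination, with weights
      \<open>c\<close>, of the coordinates of what it carries over \<open>R\<close> for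
      \<open>u c\<close>. This follows by induction along the arcs from \<open>node\<close> and
      \<open>lift_superposition\<close>.\<close>
    have z_eq: "e \<in> arcs ?G \<longrightarrow> (\<forall>j<n'. z e j =
        (\<Oplus>\<^bsub>F\<^esub>c\<in>carrier F. c \<otimes>\<^bsub>F\<^esub> \<kappa> (j mod d) (y c e (j div d))))" for e
    proof (induction e rule: wf_induct_rule[OF N.wf_arcs])
      case (1 e)
      show ?case
      proof (intro impI allI)
        fix j assume e: "e \<in> arcs ?G" and j: "j < n'"
        have "z e j = lift (IC' (tail ?G e)) ?\<beta> (IC (tail ?G e)) (\<lambda>y. ef e y (j div d)) (j mod d)
            (node_inputs N k' n' (tail ?G e) w z)"
          using z e j by (simp add: carried_def ef'_def)
        also have "\<dots> = (\<Oplus>\<^bsub>F\<^esub>c\<in>carrier F. c \<otimes>\<^bsub>F\<^esub> \<kappa> (j mod d) (ef e (?in (tail ?G e) c) (j div d)))"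
          by (rule lift_superposition[OF ef_lin[OF e j] fin mod \<beta> F(1) subset_refl in_V' node])
            (use 1 e in auto)
        also have "\<dots> = (\<Oplus>\<^bsub>F\<^esub>c\<in>carrier F. c \<otimes>\<^bsub>F\<^esub> \<kappa> (j mod d) (y c e (j div d)))"
          using y e by (simp add: carried_def)
        finally show "z e j = \<dots>" .
      qed
    qed
    have i_lt: "i < num_msgs N" using N.demands_msgs[OF v] i by auto
    show ?thesis
    proof (rule extensionalityI[of _ "{..<k' i}"])
      show "w i \<in> extensional {..<k' i}"
        using w i_lt by (auto simp: PiE_iff)
      fix j assume "j \<in> {..<k' i}"
      then have j: "j < k' i" by simp
      have "df' v i (node_inputs N k' n' v w z) j =
          lift (IC' v) ?\<beta> (IC v) (\<lambda>y. df v i y (j div d)) (j mod d) (node_inputs N k' n' v w z)"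
        using j by (simp add: df'_def)
      also have "\<dots> = (\<Oplus>\<^bsub>F\<^esub>c\<in>carrier F. c \<otimes>\<^bsub>F\<^esub> \<kappa> (j mod d) (df v i (?in v c) (j div d)))"
        by (rule lift_superposition[OF df_lin[OF v i j] fin mod \<beta> F(1) subset_refl in_V' node])
          (use z_eq in auto)
      \<comment> \<open>Each \<open>u c\<close> is an admissible message over \<open>R\<close>, so
        the original decoder returns it.\<close>
      also have "\<dots> = (\<Oplus>\<^bsub>F\<^esub>c\<in>carrier F. c \<otimes>\<^bsub>F\<^esub> \<kappa> (j mod d) (u c i (j div d)))"
        using sol u_R y v i by (simp add: is_solution_def)
      also have "\<dots> = w i j"
        using w_eq[OF i_lt j] by simp
      finally show "df' v i (node_inputs N k' n' v w z) j = w i j" .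
    qed (simp add: df'_def)
  qed
  then have "is_solution N (carrier F) k' n' ef' df'"
    using code by (auto simp: is_solution_def)
  moreover have "rate_vector N k n = rate_vector N k' n'"
    using d n by (auto simp: rate_vector_def k'_def n'_def)
  ultimately show ?thesis
    using lin' unfolding linearly_achievable_def by blast
qed

section \<open>Characteristic of the field, torsion of the ring, and conclusion\<close>

lemma prime_ring_char:
  assumes "field F" "finite (carrier F)"
  shows "prime (ring_char F)" and "[ring_char F] \<cdot>\<^bsub>F\<^esub> \<one>\<^bsub>F\<^esub> = \<zero>\<^bsub>F\<^esub>"
proof -
  interpret F: field F by fact
  let ?p = "ring_char F"
  \<comment> \<open>The characteristic is the additive order of one, so it divides exactly the
    integers whose multiple of one vanishes. Primality is then the absence of zero divisors.\<close>
  have multiple_eq_0: "[m] \<cdot>\<^bsub>F\<^esub> \<one>\<^bsub>F\<^esub> = \<zero>\<^bsub>F\<^esub> \<longleftrightarrow> ?p dvd m" for m :: nat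
    using F.add.pow_eq_id[of "\<one>\<^bsub>F\<^esub>" m] by (simp add: ring_char_def)
  then show "[?p] \<cdot>\<^bsub>F\<^esub> \<one>\<^bsub>F\<^esub> = \<zero>\<^bsub>F\<^esub>" by simp
  have "?p \<noteq> 0"
    using F.add.ord_ge_1[of "\<one>\<^bsub>F\<^esub>"] assms(2) by (simp add: ring_char_def)
  moreover have "?p \<noteq> 1"
    using multiple_eq_0[of 1] by auto
  moreover have "?p dvd m \<or> ?p dvd n" if "?p dvd m * n" for m n
  proof -
    have "([m] \<cdot>\<^bsub>F\<^esub> \<one>\<^bsub>F\<^esub>) \<otimes>\<^bsub>F\<^esub> ([n] \<cdot>\<^bsub>F\<^esub> \<one>\<^bsub>F\<^esub>) = [m] \<cdot>\<^bsub>F\<^esub> ([n] \<cdot>\<^bsub>F\<^esub> \<one>\<^bsub>F\<^esub>)"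
      by (simp add: F.add_pow_ldistr)
    also have "\<dots> = \<zero>\<^bsub>F\<^esub>"
      using that by (simp add: F.add.nat_pow_pow multiple_eq_0 mult.commute)
    finally show ?thesis
      by (simp add: F.integral_iff multiple_eq_0)
  qed
  ultimately have "prime_elem ?p"
    by (intro prime_elemI) simp_all
  then show "prime ?p" by simp
qed

lemma (in ring) ideal_torsion:
  fixes p :: nat
  shows "ideal {x \<in> carrier R. [p] \<cdot> x = \<zero>} R"
proof (rule idealI)
  show "subgroup {x \<in> carrier R. [p] \<cdot> x = \<zero>} (add_monoid R)"
    by (rule add.subgroupI) (auto simp: add.nat_pow_distrib add.nat_pow_inv simp flip: a_inv_def)
  fix a x assume ax: "a \<in> {x \<in> carrier R. [p] \<cdot> x = \<zero>}" "x \<in> carrier R"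
  then show "x \<otimes> a \<in> {x \<in> carrier R. [p] \<cdot> x = \<zero>}"
    using add_pow_rdistr[of x a p] by simp
  show "a \<otimes> x \<in> {x \<in> carrier R. [p] \<cdot> x = \<zero>}"
    using ax add_pow_ldistr[of a x p] by simp
qed (rule ring_axioms)

text \<open>Cauchy's theorem for the additive group. Sylow's theorem with exponent one gives a
  subgroup of order \<open>p\<close>; it has a nonzero element, and \<open>p\<close> annihilates
  each of its elements.\<close>

lemma (in ring) ex_torsion:
  assumes "finite (carrier R)" "prime p" "p dvd card (carrier R)"
  shows "\<exists>x\<in>carrier R. [p] \<cdot> x = \<zero> \<and> x \<noteq> \<zero>"
proof -
  obtain m where "order (add_monoid R) = p ^ 1 * m"
    using assms(3) by (auto simp: order_def)
  then obtain H where H: "subgroup H (add_monoid R)" "card H = p"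
    using sylow_thm[OF assms(2) add.is_group, of 1 m] assms(1) by auto
  interpret H: subgroup H "add_monoid R" by fact
  interpret H_group: group "add_monoid R\<lparr>carrier := H\<rparr>"
    using add.subgroup_imp_group[OF H(1)] .
  have "\<not> H \<subseteq> {\<zero>}"
    using H(2) prime_gt_1_nat[OF assms(2)] card_mono[of "{\<zero>}" H] by auto
  then obtain x where x: "x \<in> H" "x \<noteq> \<zero>" by auto
  have "x [^]\<^bsub>add_monoid R\<lparr>carrier := H\<rparr>\<^esub> p = \<zero>"
    using H_group.pow_order_eq_1[of x] x H(2) by (simp add: order_def)
  then have "[p] \<cdot> x = \<zero>"
    by (simp add: add_pow_def nat_pow_def)
  then show ?thesis using x H.mem_carrier by auto
qed

theorem theorem4p2:
  fixes R :: "('a, 'r) ring_scheme" and F :: "('b, 'f) ring_scheme" and N :: "('v, 'e) net"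
  assumes "ring R" and "finite (carrier R)"
    and "field F" and "finite (carrier F)"
    and "ring_char F dvd card (carrier R)"
    and "network N"
  shows "linear_rate_region N R \<subseteq> linear_rate_region N F"
proof -
  interpret R: ring R by fact
  interpret F: field F by fact
  define p where "p = ring_char F"
  have p: "prime p" "[p] \<cdot>\<^bsub>F\<^esub> \<one>\<^bsub>F\<^esub> = \<zero>\<^bsub>F\<^esub>"
    unfolding p_def using prime_ring_char[OF assms(3,4)] by auto
  define V where "V = {x \<in> carrier R. [p] \<cdot>\<^bsub>R\<^esub> x = \<zero>\<^bsub>R\<^esub>}"
  interpret V: ideal V R
    unfolding V_def by (rule R.ideal_torsion)
  have fin: "finite (carrier (R\<lparr>carrier := V\<rparr>))"
    using finite_subset[OF V.a_subset assms(2)] by simp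
  have tors: "[p] \<cdot>\<^bsub>R\<lparr>carrier := V\<rparr>\<^esub> x = \<zero>\<^bsub>R\<lparr>carrier := V\<rparr>\<^esub>" if "x \<in> carrier (R\<lparr>carrier := V\<rparr>)" for x
  proof -
    have "[p] \<cdot>\<^bsub>R\<lparr>carrier := V\<rparr>\<^esub> x = [p] \<cdot>\<^bsub>R\<^esub> x"
      by (simp add: add_pow_def nat_pow_def)
    then show ?thesis using that unfolding V_def by simp
  qed
  \<comment> \<open>Divisibility of the order of \<open>R\<close> by \<open>p\<close> enters here.
    It forces \<open>d > 0\<close>, which keeps the new block length \<open>n * d\<close>
    positive.\<close>
  have V: "V \<noteq> {\<zero>\<^bsub>R\<^esub>}"
    using R.ex_torsion[OF assms(2) p(1)] assms(5) unfolding V_def p_def by blast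
  have "\<exists>d b \<kappa>. ideal_coordinates R V F d b \<kappa> \<and> d > 0"
  proof (rule ex_dual_basis[OF V.abelian_group_restrict fin p(1) tors F.ring_axioms p(2)])
    fix d :: nat and b :: "nat \<Rightarrow> 'a" and \<kappa> :: "nat \<Rightarrow> 'a \<Rightarrow> 'b"
    let ?V = "R\<lparr>carrier := V\<rparr>"
    assume basis: "\<And>l. l < d \<Longrightarrow> b l \<in> carrier ?V"
      "\<And>l. l < d \<Longrightarrow> \<kappa> l \<in> hom (add_monoid ?V) (add_monoid F)"
      "\<And>l l'. l < d \<Longrightarrow> l' < d \<Longrightarrow> \<kappa> l (b l') = (if l = l' then \<one>\<^bsub>F\<^esub> else \<zero>\<^bsub>F\<^esub>)"
      "\<And>\<psi> v. \<psi> \<in> hom (add_monoid ?V) (add_monoid F) \<Longrightarrow> v \<in> carrier ?V \<Longrightarrow>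
        \<psi> v = (\<Oplus>\<^bsub>F\<^esub>l\<in>{..<d}. \<kappa> l v \<otimes>\<^bsub>F\<^esub> \<psi> (b l))"
    assume d: "carrier ?V \<noteq> {\<zero>\<^bsub>?V\<^esub>} \<Longrightarrow> d > 0"
    have "ideal_coordinates_axioms R V F d b \<kappa>"
      using basis by (intro ideal_coordinates_axioms.intro) simp_all
    then have "ideal_coordinates R V F d b \<kappa>"
      by (intro ideal_coordinates.intro R.ring_axioms V.ideal_axioms F.cring_axioms)
    with d V show ?thesis by auto
  qed
  then obtain d b \<kappa> where "ideal_coordinates R V F d b \<kappa>" "d > 0" by blast
  interpret ideal_coordinates R V F d b \<kappa> by fact
  \<comment> \<open>Zero and one are distinct in a field, so \<open>F\<close> is large enough to be
    an alphabet.\<close>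
  have "card {\<zero>\<^bsub>F\<^esub>, \<one>\<^bsub>F\<^esub>} \<le> card (carrier F)"
    using assms(4) by (intro card_mono) auto
  then have "card (carrier F) \<ge> 2" by simp
  then show ?thesis
    using linearly_achievable_transfer[OF assms(6) \<open>d > 0\<close> assms(4)]
    by (auto simp: linear_rate_region_def linearly_achievable_def[of N R])
qed

end
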